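(* Let $a<b$ be real numbers, let $n\geq 1$ be an integer, let $f$ be a real mapping defined on $[a,b]$ which belongs to $\mathcal{C}^2([a,b])$, and let $m_2,M_2\in\mathbb{R}$ be such that $m_2\leq f''(x)\leq M_2$ for all $x\in[a,b]$. Let $x_k=a+t_k(b-a)$, $k=0,\dots,n$, be points of $[a,b]$ with $0\leq t_k\leq 1$, $x_0=a$ and $x_n=b$ (so $t_0=0$ and $t_n=1$), and let $\omega_0,\dots,\omega_n$ be real weights. Put $S_k=\sum_{j=0}^k\omega_j$, and let $\epsilon^*_n(a,b)$ be the real number defined by $$f(b)=f(a)+(b-a)\left(\sum_{k=0}^n\omega_k f'(x_k)\right)+(b-a)\,\epsilon^*_n(a,b).$$ Then $$\frac{b-a}{2}\sum_{k=0}^{n-1}\Big[m_2(S_k-t_k)^2-M_2(S_k-t_{k+1})^2\Big]\leq\epsilon^*_n(a,b)\leq\frac{b-a}{2}\sum_{k=0}^{n-1}\Big[M_2(S_k-t_k)^2-m_2(S_k-t_{k+1})^2\Big].$$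
   Formalization: The weights are additionally assumed to satisfy ω_0+…+ω_n=1; without this the claim fails, e.g. for f(x)=x on [0,1], n=1, all weights 0 and m_2=M_2=0, where ε*_n=1 but both bounds are 0. *)

theory Defs
  imports Complex_Main
begin

end

theory Submission
  imports Defs
begin

text \<open>
  For real \<open>s\<close> put \<open>F u = f u + (s - u) * f' u\<close>, the value at \<open>s\<close> of the tangent of \<open>f\<close> at \<open>u\<close>,
  so that \<open>F' u = (s - u) * f'' u\<close>. With \<open>s = a + S k * (b - a)\<close>, summation by parts turns
  \<open>(b - a) * \<epsilon>\<close> into the sum of the increments of \<open>F\<close> from \<open>x k\<close> to \<open>x (k + 1)\<close>.
  On \<open>[a, b]\<close>, \<open>F u + m2 * (s - u)\<^sup>2 / 2\<close> is maximal and \<open>F u + M2 * (s - u)\<^sup>2 / 2\<close> is minimal at the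
  point \<open>c\<close> nearest to \<open>s\<close>. Comparing both with their values at \<open>c\<close> bounds every increment from
  above, and from below after exchanging the two end points.
\<close>

text \<open>The derivative has the sign of \<open>s - u\<close>, so \<open>G\<close> rises before
  \<open>s\<close> and falls after it. The clamped point also covers \<open>s\<close> outside
  \<open>[a, b]\<close>, where \<open>G\<close> is monotone on the whole interval.\<close>

lemma max_at_nearest_point:
  fixes G h :: "real \<Rightarrow> real"
  assumes G: "\<And>u. u \<in> {a..b} \<Longrightarrow> (G has_real_derivative (s - u) * h u) (at u within {a..b})"
    and h: "\<And>u. u \<in> {a..b} \<Longrightarrow> 0 \<le> h u"
    and p: "p \<in> {a..b}"
  shows "G p \<le> G (max a (min b s))"
proof -
  define c where "c = max a (min b s)"
  have cont: "continuous_on {a..b} G"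
    using G by (rule DERIV_continuous_on)
  \<comment> \<open>Two-sided derivatives exist only in the interior; at the end points of the
    interval, continuity takes over in the monotonicity arguments below.\<close>
  have deriv: "(G has_real_derivative (s - u) * h u) (at u)" if "a < u" "u < b" for u
    using G[of u] that by (simp add: at_within_Icc_at)
  show ?thesis
  proof (cases "p \<le> s")
    case True
    then have "p \<le> c" "c \<le> b" "\<And>u. u < c \<Longrightarrow> u \<ge> p \<Longrightarrow> u \<le> s"
      using p by (auto simp: c_def)
    moreover have "continuous_on {p..c} G"
      by (rule continuous_on_subset[OF cont]) (use p \<open>c \<le> b\<close> in auto)
    moreover have "\<exists>y. (G has_real_derivative y) (at u) \<and> 0 \<le> y" if "p < u" "u < c" for u
      by (intro exI conjI, rule deriv) (use that p h calculation in auto)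
    ultimately have "G p \<le> G c"
      using DERIV_nonneg_imp_increasing_open[of p c G] by blast
    then show ?thesis by (simp add: c_def)
  next
    case False
    then have "c \<le> p" "a \<le> c" "\<And>u. c < u \<Longrightarrow> u \<le> p \<Longrightarrow> s \<le> u"
      using p by (auto simp: c_def)
    moreover have "continuous_on {c..p} G"
      by (rule continuous_on_subset[OF cont]) (use p \<open>a \<le> c\<close> in auto)
    moreover have "\<exists>y. (G has_real_derivative y) (at u) \<and> y \<le> 0" if "c < u" "u < p" for u
      by (intro exI conjI, rule deriv)
        (use that p h calculation in \<open>auto simp: mult_nonpos_nonneg\<close>)
    ultimately have "G p \<le> G c"
      using DERIV_nonpos_imp_decreasing_open[of c p G] by blast
    then show ?thesis by (simp add: c_def)
  qed
qed

lemma tangent_value_increment_le: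
  fixes f f' f'' :: "real \<Rightarrow> real"
  assumes f: "\<And>u. u \<in> {a..b} \<Longrightarrow> (f has_real_derivative f' u) (at u within {a..b})"
    and f': "\<And>u. u \<in> {a..b} \<Longrightarrow> (f' has_real_derivative f'' u) (at u within {a..b})"
    and bounds: "\<And>u. u \<in> {a..b} \<Longrightarrow> m \<le> f'' u \<and> f'' u \<le> M"
    and p: "p \<in> {a..b}" and q: "q \<in> {a..b}"
  shows "(f q + (s - q) * f' q) - (f p + (s - p) * f' p) \<le> (M * (s - p)\<^sup>2 - m * (s - q)\<^sup>2) / 2"
proof -
  define F where "F u = f u + (s - u) * f' u" for u
  define c where "c = max a (min b s)"
  have F: "(F has_real_derivative (s - u) * f'' u) (at u within {a..b})" if "u \<in> {a..b}" for u
    unfolding F_def by (auto intro!: derivative_eq_intros f f' that simp: algebra_simps)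
  \<comment> \<open>The function of \<open>u\<close> compared here has derivative
    \<open>(s - u) * (f'' u - m)\<close>.\<close>
  have "F q + m * (s - q)\<^sup>2 / 2 \<le> F c + m * (s - c)\<^sup>2 / 2"
    unfolding c_def
    by (rule max_at_nearest_point[where h = "\<lambda>u. f'' u - m"])
      (use bounds q in \<open>auto intro!: derivative_eq_intros F simp: field_simps\<close>)
  \<comment> \<open>The value of \<open>f''\<close> at \<open>p\<close> lies between
    \<open>m\<close> and \<open>M\<close>, whence \<open>m \<le> M\<close>.\<close>
  also have "\<dots> \<le> F c + M * (s - c)\<^sup>2 / 2"
    using bounds[OF p] by (simp add: mult_right_mono)
  also have "\<dots> \<le> F p + M * (s - p)\<^sup>2 / 2"
  proof -
    have "- (F p + M * (s - p)\<^sup>2 / 2) \<le> - (F c + M * (s - c)\<^sup>2 / 2)"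
      unfolding c_def
      by (rule max_at_nearest_point[where h = "\<lambda>u. M - f'' u"])
        (use bounds p in \<open>auto intro!: derivative_eq_intros F simp: field_simps\<close>)
    then show ?thesis by simp
  qed
  finally show ?thesis by (simp add: F_def diff_divide_distrib)
qed

text \<open>Induction on \<open>n\<close>: since \<open>\<sigma>\<close> grows by
  \<open>d * \<omega> (Suc n)\<close>, the new weighted term turns \<open>\<sigma> (Suc n)\<close>
  into \<open>\<sigma> n\<close> in the boundary term. For \<open>n = 0\<close> the boundary term
  cancels the single weighted term.\<close>

lemma sum_tangent_value_increments:
  fixes f f' :: "real \<Rightarrow> real" and x \<omega> \<sigma> :: "nat \<Rightarrow> real"
  assumes "\<And>k. k \<le> n \<Longrightarrow> \<sigma> k = x 0 + d * (\<Sum>j=0..k. \<omega> j)"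
  shows "(\<Sum>k<n. (f (x (k + 1)) + (\<sigma> k - x (k + 1)) * f' (x (k + 1)))
                - (f (x k) + (\<sigma> k - x k) * f' (x k)))
       = f (x n) - f (x 0) + (\<sigma> n - x n) * f' (x n) - d * (\<Sum>k=0..n. \<omega> k * f' (x k))"
  using assms
proof (induction n)
  case 0
  then show ?case by simp
next
  case (Suc n)
  have "\<sigma> (Suc n) = \<sigma> n + d * \<omega> (Suc n)"
    using Suc.prems[of n] Suc.prems[of "Suc n"] by (simp add: algebra_simps)
  then show ?case
    using Suc.IH Suc.prems by (simp add: algebra_simps)
qed

theorem theorem2p3:
  fixes a b m2 M2 \<epsilon> :: real
    and n :: nat
    and f f' f'' :: "real \<Rightarrow> real"
    and t x \<omega> S :: "nat \<Rightarrow> real"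
  assumes "a < b"
    and "n \<ge> 1"
    and "\<And>y. y \<in> {a..b} \<Longrightarrow> (f has_real_derivative f' y) (at y within {a..b})"
    and "\<And>y. y \<in> {a..b} \<Longrightarrow> (f' has_real_derivative f'' y) (at y within {a..b})"
    and "continuous_on {a..b} f''"
    and "\<And>y. y \<in> {a..b} \<Longrightarrow> m2 \<le> f'' y \<and> f'' y \<le> M2"
    and "\<And>k. k \<le> n \<Longrightarrow> 0 \<le> t k \<and> t k \<le> 1"
    and "\<And>k. k \<le> n \<Longrightarrow> x k = a + t k * (b - a)"
    and "x 0 = a"
    and "x n = b"
    and "(\<Sum>k=0..n. \<omega> k) = 1"
    and "\<And>k. k \<le> n \<Longrightarrow> S k = (\<Sum>j=0..k. \<omega> j)"
    and "f b = f a + (b - a) * (\<Sum>k=0..n. \<omega> k * f' (x k)) + (b - a) * \<epsilon>"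
  shows "(b - a) / 2 * (\<Sum>k=0..n-1. m2 * (S k - t k)^2 - M2 * (S k - t (k + 1))^2) \<le> \<epsilon>
       \<and> \<epsilon> \<le> (b - a) / 2 * (\<Sum>k=0..n-1. M2 * (S k - t k)^2 - m2 * (S k - t (k + 1))^2)"
proof -
  note ab = assms(1) and n = assms(2) and xt = assms(8) and S = assms(12) and eps = assms(13)
  define \<sigma> where "\<sigma> k = a + S k * (b - a)" for k
  define F where "F k u = f u + (\<sigma> k - u) * f' u" for k u
  \<comment> \<open>For \<open>n = 0\<close> truncated subtraction would leave the index 0 on the
    left.\<close>
  have index: "{0..n - 1} = {..<n}"
    using n by auto
  have "(\<Sum>k<n. F k (x (k + 1)) - F k (x k))
      = f (x n) - f (x 0) + (\<sigma> n - x n) * f' (x n) - (b - a) * (\<Sum>k=0..n. \<omega> k * f' (x k))"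
    unfolding F_def
    by (rule sum_tangent_value_increments) (simp add: \<sigma>_def S assms(9) mult.commute)
  \<comment> \<open>The weights sum to 1, so \<open>S n = 1\<close> and the boundary term
    vanishes.\<close>
  moreover have "\<sigma> n = x n"
    using S[of n] assms(10,11) by (simp add: \<sigma>_def)
  ultimately have "(\<Sum>k<n. F k (x (k + 1)) - F k (x k)) = (b - a) * \<epsilon>"
    using eps assms(9,10) by simp
  then have sum: "\<epsilon> = (\<Sum>k<n. (F k (x (k + 1)) - F k (x k)) / (b - a))"
    using ab by (simp flip: sum_divide_distrib)
  have x: "x k \<in> {a..b}" if "k \<le> n" for k
  proof -
    have "0 \<le> t k * (b - a)" "t k * (b - a) \<le> b - a"
      using assms(7)[OF that] ab by (auto simp: mult_left_le_one_le)
    then show ?thesis by (auto simp: xt[OF that])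
  qed
  \<comment> \<open>Both points are images of \<open>S k\<close> and \<open>t j\<close> under the
    same affine map of slope \<open>b - a\<close>.\<close>
  have sq: "(\<sigma> k - x j)\<^sup>2 = (b - a)\<^sup>2 * (S k - t j)\<^sup>2" if "j \<le> n" for k j
    by (simp add: \<sigma>_def xt[OF that] algebra_simps power2_eq_square)
  \<comment> \<open>The indices \<open>i\<close> and \<open>j\<close> are free because the nodes
    need not be ordered and the lower bound uses them exchanged.\<close>
  have incr: "(F k (x j) - F k (x i)) / (b - a)
      \<le> (b - a) / 2 * (M2 * (S k - t i)\<^sup>2 - m2 * (S k - t j)\<^sup>2)" if "i \<le> n" "j \<le> n" for i j k
  proof -
    have "F k (x j) - F k (x i) \<le> (M2 * (\<sigma> k - x i)\<^sup>2 - m2 * (\<sigma> k - x j)\<^sup>2) / 2"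
      unfolding F_def using assms(3,4,6) x[OF that(1)] x[OF that(2)]
      by (rule tangent_value_increment_le)
    also have "\<dots> = (b - a) / 2 * (M2 * (S k - t i)\<^sup>2 - m2 * (S k - t j)\<^sup>2) * (b - a)"
      unfolding sq[OF that(1)] sq[OF that(2)] by (simp add: field_simps power2_eq_square)
    finally show ?thesis
      using ab by (simp add: pos_divide_le_eq)
  qed
  show ?thesis
    unfolding index sum sum_distrib_left
  proof (intro conjI sum_mono)
    fix k assume "k \<in> {..<n}"
    then have "k \<le> n" "k + 1 \<le> n" by auto
    then show "(F k (x (k + 1)) - F k (x k)) / (b - a)
        \<le> (b - a) / 2 * (M2 * (S k - t k)\<^sup>2 - m2 * (S k - t (k + 1))\<^sup>2)"
      by (rule incr)
    have "- ((b - a) / 2 * (M2 * (S k - t (k + 1))\<^sup>2 - m2 * (S k - t k)\<^sup>2))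
        \<le> - ((F k (x k) - F k (x (k + 1))) / (b - a))"
      using incr[OF \<open>k + 1 \<le> n\<close> \<open>k \<le> n\<close>, of k] by (simp only: neg_le_iff_le)
    then show "(b - a) / 2 * (m2 * (S k - t k)\<^sup>2 - M2 * (S k - t (k + 1))\<^sup>2)
        \<le> (F k (x (k + 1)) - F k (x k)) / (b - a)"
      by (simp only: minus_divide_left mult_minus_right[symmetric] minus_diff_eq)
  qed
qed

end
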